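(* Let $G_1$ and $G_2$ be two simple connected graphs with $n$ vertices such that $G_2=\mathrm{GGS}(G_1)$. Then $W(G_1)\ge W(G_2)$, where $W$ denotes the Wiener index.
   Context: The Wiener index of a connected graph $G$ is $W(G)=\sum_{i,j\in G}d_G(i,j)$, where $d_G(i,j)$ is the shortest-path distance between the vertices $i$ and $j$ in $G$. Generalized graph shift (GGS): let $G_1$ be a graph and let $u$ and $w$ be two distinct vertices of $G_1$ connected by a path $P$ from $u$ to $w$ such that (1) every interior vertex of $P$ (if any) has degree 2 in $G_1$, and (2) $u$ and $w$ are not both contained in one cycle of $G_1$. Let $w'$ be the neighbour of $w$ on $P$. Then $G_2=\mathrm{GGS}(G_1)$ is obtained from $G_1$ by moving all neighbours of $w$ except $w'$ to $u$, i.e. for each neighbour $z\ne w'$ of $w$, the edge $\{w,z\}$ is deleted and the edge $\{u,z\}$ is added. *)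

theory Defs
  imports "Graph_Theory.Graph_Theory"
begin

text \<open>
  A finite simple graph is a \<^const>\<open>pair_graph\<close>: a finite, loop-free, symmetric digraph whose
  arcs are pairs of vertices, an edge between \<open>u\<close> and \<open>v\<close> being the two arcs \<open>(u, v)\<close> and \<open>(v, u)\<close>.
  In particular, the degree of a vertex is its \<^const>\<open>out_degree\<close>.
\<close>

definition graph_dist :: "'a pair_pre_digraph \<Rightarrow> 'a \<Rightarrow> 'a \<Rightarrow> ereal" where
  "graph_dist G u v = wf_digraph.\<mu> (with_proj G) (\<lambda>_. 1) u v"

text \<open>
  The sum is over ordered pairs. The value is an extended real only because the library's
  \<open>\<mu>\<close> is; it is finite for connected graphs.
\<close>

definition wiener_index :: "'a pair_pre_digraph \<Rightarrow> ereal" where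
  "wiener_index G = (\<Sum>i\<in>pverts G. \<Sum>j\<in>pverts G. graph_dist G i j)"

text \<open>
  The library's cycles include the closed walk \<open>u, v, u\<close> along a single edge; the length condition
  excludes it. All vertices of a cycle occur as tails of its arcs.
\<close>

definition in_common_cycle :: "'a pair_pre_digraph \<Rightarrow> 'a \<Rightarrow> 'a \<Rightarrow> bool" where
  "in_common_cycle G u w \<longleftrightarrow>
     (\<exists>c. pre_digraph.cycle (with_proj G) c \<and> 3 \<le> length c \<and> u \<in> fst ` set c \<and> w \<in> fst ` set c)"

definition move_neighbours :: "'a pair_pre_digraph \<Rightarrow> 'a \<Rightarrow> 'a set \<Rightarrow> 'a \<Rightarrow> 'a pair_pre_digraph" where
  "move_neighbours G w Z u =
     \<lparr> pverts = pverts G,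
       parcs = (parcs G - (\<Union>z\<in>Z. {(w, z), (z, w)})) \<union> (\<Union>z\<in>Z. {(u, z), (z, u)}) \<rparr>"

text \<open>
  The path \<open>P\<close> is a list of arcs, so its last arc is \<open>(w', w)\<close>.
\<close>

definition GGS :: "'a pair_pre_digraph \<Rightarrow> 'a pair_pre_digraph \<Rightarrow> bool" where
  "GGS G1 G2 \<longleftrightarrow>
     (\<exists>u w P. u \<noteq> w \<and>
        pre_digraph.apath (with_proj G1) u P w \<and>
        (\<forall>x \<in> set (pre_digraph.awalk_verts (with_proj G1) u P) - {u, w}.
            out_degree (with_proj G1) x = 2) \<and>
        \<not> in_common_cycle G1 u w \<and>
        (let w' = fst (last P)
         in G2 = move_neighbours G1 w {z. (w, z) \<in> parcs G1 \<and> z \<noteq> w'} u))"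

end

theory Submission
  imports Defs
begin

text \<open>
  The path \<open>P\<close> consists of bridges: a walk from \<open>w\<close> back to \<open>u\<close> that avoids its edges would close
  \<open>P\<close> up to a cycle through \<open>u\<close> and \<open>w\<close>, since the interior vertices of \<open>P\<close> have no other edges.
  So the graph consists of the path, a part \<open>A\<close> attached at \<open>u\<close> and a part \<open>B\<close> attached at \<open>w\<close>
  (both ends belong to the path, not to \<open>A\<close> or \<open>B\<close>), and the shift reattaches \<open>B\<close> at \<open>u\<close>, leaving \<open>P\<close> as a pendant path.

  Distances inside \<open>A \<union> P\<close> and inside \<open>B\<close> are unchanged, and distances between \<open>A\<close> and \<open>B\<close> shrink by
  the length of \<open>P\<close>. The distance from a vertex of \<open>P\<close> to \<open>B\<close> may well grow, but it equals the old
  distance from the mirror image of that vertex on \<open>P\<close>. Hence, after a permutation of the ordered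
  pairs that reflects \<open>P\<close> in the pairs between \<open>P\<close> and \<open>B\<close>, every new distance is at most
  the corresponding old one (\<open>dist_exchange_le\<close>), and the Wiener indices compare termwise.

  Only these upper bounds on new distances are needed. Each comes from a map of vertices that
  sends every old edge to a new edge or to a single vertex, and so does not increase
  distances (\<open>graph_dist_lazy_hom\<close>). Three maps suffice, because each one may collapse the parts
  that do not matter for the pairs at hand: collapse \<open>B\<close> to \<open>w\<close>; collapse \<open>P\<close> to \<open>u\<close>;
  reflect \<open>P\<close> and collapse \<open>A\<close> to \<open>w\<close>.
\<close>

section \<open>Maps that do not increase distances\<close>

definition lazy_hom :: "('a \<Rightarrow> 'b) \<Rightarrow> 'a pair_pre_digraph \<Rightarrow> 'b pair_pre_digraph \<Rightarrow> bool" where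
  "lazy_hom f G H \<longleftrightarrow> f ` pverts G \<subseteq> pverts H \<and>
     (\<forall>(x, y) \<in> parcs G. f x = f y \<or> (f x, f y) \<in> parcs H)"

lemma lazy_hom_awalk:
  assumes "pair_wf_digraph G" "pair_wf_digraph H" and f: "lazy_hom f G H"
    and "pre_digraph.awalk (with_proj G) x p y"
  shows "\<exists>q. pre_digraph.awalk (with_proj H) (f x) q (f y) \<and> length q \<le> length p"
  using assms(4)
proof (induction p arbitrary: x)
  interpret G: pair_wf_digraph G by fact
  interpret H: pair_wf_digraph H by fact
  {
    case Nil
    then have "f x \<in> pverts H" "y = x"
      using f by (auto simp: G.awalk_Nil_iff lazy_hom_def)
    then show ?case by (auto simp: H.awalk_Nil_iff intro!: exI[of _ "[]"])
  next
    case (Cons e es)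
    then have e: "e \<in> parcs G" "x = fst e" and "G.awalk (snd e) es y"
      by (auto simp: G.awalk_Cons_iff)
    then obtain q where q: "H.awalk (f (snd e)) q (f y)" "length q \<le> length es"
      using Cons.IH by blast
    from f e have "f x = f (snd e) \<or> (f x, f (snd e)) \<in> parcs H"
      by (cases e) (auto simp: lazy_hom_def)
    then show ?case
    proof
      assume "f x = f (snd e)"
      with q show ?thesis by (intro exI[of _ q]) auto
    next
      assume "(f x, f (snd e)) \<in> parcs H"
      with q show ?thesis
        by (intro exI[of _ "(f x, f (snd e)) # q"]) (auto simp: H.awalk_Cons_iff)
    qed
  }
qed

lemma graph_dist_eq_Inf_length:
  assumes "pair_wf_digraph G"
  shows "graph_dist G x y = (INF p\<in>{p. pre_digraph.awalk (with_proj G) x p y}. ereal (length p))"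
proof -
  interpret pair_wf_digraph G by fact
  show ?thesis
    by (simp add: graph_dist_def \<mu>_def awalk_cost_def sum_list_triv)
qed

lemma graph_dist_lazy_hom:
  assumes "pair_wf_digraph G" "pair_wf_digraph H" "lazy_hom f G H"
  shows "graph_dist H (f x) (f y) \<le> graph_dist G x y"
  unfolding graph_dist_eq_Inf_length[OF assms(1)] graph_dist_eq_Inf_length[OF assms(2)]
proof (rule INF_mono)
  fix p assume "p \<in> {p. pre_digraph.awalk (with_proj G) x p y}"
  then show "\<exists>q\<in>{q. pre_digraph.awalk (with_proj H) (f x) q (f y)}. ereal (length q) \<le> ereal (length p)"
    using lazy_hom_awalk[OF assms] by force
qed

section \<open>The two sides of a path of bridges\<close>

locale shift_path = pair_graph G for G :: "'a pair_pre_digraph" +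
  fixes u w :: 'a and P :: "('a \<times> 'a) awalk"
  assumes ends: "u \<noteq> w"
    and path: "apath u P w"
    and interior_degree: "\<And>x. x \<in> set (awalk_verts u P) - {u, w} \<Longrightarrow> out_degree (with_proj G) x = 2"
    and no_cycle: "\<not> in_common_cycle G u w"
begin

definition path_verts :: "'a list" where "path_verts = awalk_verts u P"

definition path_arcs :: "('a \<times> 'a) set" where "path_arcs = set P \<union> (set P)\<inverse>"

text \<open>
  This is the part \<open>B\<close> together with \<open>w\<close>. All other vertices off the path serve as \<open>A\<close>: they are not
  adjacent to the far side, which is closed under edges off the path, nor to interior vertices
  of the path, which have no other edges, so \<open>A\<close> meets the rest only at \<open>u\<close>.
\<close>

definition far_side :: "'a set" where
  "far_side = {x. \<exists>q. awalk w q x \<and> set q \<inter> path_arcs = {}}"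

lemma path_nonempty: "P \<noteq> []"
  using path ends by (auto simp: apath_Nil_iff)

lemma distinct_path_verts: "distinct path_verts"
  using path by (simp add: apath_def path_verts_def)

lemma length_path_verts: "length path_verts = Suc (length P)"
  by (simp add: path_verts_def length_awalk_verts)

lemma path_nth:
  assumes "i < length P"
  shows "P ! i = (path_verts ! i, path_verts ! Suc i)"
proof -
  have "cas u P w"
    using path by (auto simp: apath_def)
  then have "path_verts = fst (hd P) # map snd P"
    using awalk_verts_conv'[of u P w] path_nonempty by (simp add: path_verts_def)
  moreover have "path_verts = map fst P @ [snd (last P)]"
    using awalk_verts_conv[of u P] path_nonempty by (simp add: path_verts_def)
  ultimately have "path_verts ! Suc i = snd (P ! i)" "path_verts ! i = fst (P ! i)"
    using assms by (metis nth_Cons_Suc nth_map) (metis \<open>path_verts = map fst P @ _\<close> assms length_map nth_append nth_map)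
  then show ?thesis by simp
qed

lemma path_verts_first: "path_verts ! 0 = u"
  using path awhd_of_awalk[of u P w] hd_conv_nth[of path_verts]
  by (simp add: path_verts_def apath_def)

lemma path_verts_last: "path_verts ! length P = w"
proof -
  have "last path_verts = w"
    using path awlast_if_cas[of u P w] by (auto simp: path_verts_def apath_def)
  moreover have "path_verts \<noteq> []"
    using length_path_verts by auto
  ultimately show ?thesis
    using last_conv_nth[of path_verts] by (simp add: length_path_verts)
qed

lemma mem_path_verts: "x \<in> set path_verts \<longleftrightarrow> (\<exists>i\<le>length P. x = path_verts ! i)"
  by (auto simp: in_set_conv_nth length_path_verts less_Suc_eq_le)

lemma ends_in_path_verts: "u \<in> set path_verts" "w \<in> set path_verts"
  using path_verts_first path_verts_last by (auto simp: mem_path_verts)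

lemma path_verts_subset: "set path_verts \<subseteq> pverts G"
  using path by (auto simp: path_verts_def apath_def)

lemma mem_path: "(x, y) \<in> set P \<longleftrightarrow> (\<exists>i<length P. x = path_verts ! i \<and> y = path_verts ! Suc i)"
  by (metis in_set_conv_nth path_nth prod.inject)

lemma path_arcs_in_path_verts:
  assumes "(x, y) \<in> path_arcs"
  shows "x \<in> set path_verts" "y \<in> set path_verts"
  using assms by (auto simp: path_arcs_def mem_path mem_path_verts intro: Suc_leI less_imp_le)

lemma path_arcs_sym: "(x, y) \<in> path_arcs \<longleftrightarrow> (y, x) \<in> path_arcs"
  by (auto simp: path_arcs_def)

lemma path_arcs_subset: "path_arcs \<subseteq> parcs G"
  using path by (auto simp: path_arcs_def apath_def awalk_def intro: arcs_symmetric)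

text \<open>At an interior vertex, the predecessor and the successor on the path already account for the degree 2.\<close>

lemma interior_arc:
  assumes y: "y \<in> set path_verts" "y \<noteq> u" "y \<noteq> w" and t: "(y, t) \<in> parcs G"
  shows "(y, t) \<in> path_arcs"
proof -
  obtain i where i: "i \<le> length P" "y = path_verts ! i"
    using y(1) mem_path_verts by blast
  have "i \<noteq> 0" "i \<noteq> length P"
    using i y path_verts_first path_verts_last by metis+
  then obtain j where j: "i = Suc j" by (cases i) auto
  define x z where "x = path_verts ! j" and "z = path_verts ! Suc i"
  have xy: "(x, y) \<in> set P" and yz: "(y, z) \<in> set P"
    using i j \<open>i \<noteq> length P\<close> le_neq_implies_less
    unfolding mem_path x_def z_def by (metis Suc_lessD)+
  have "x \<noteq> z"
    using nth_eq_iff_index_eq[OF distinct_path_verts, of j "Suc i"] i j \<open>i \<noteq> length P\<close>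
    by (auto simp: x_def z_def length_path_verts)
  have "{(y, x), (y, z)} \<subseteq> path_arcs"
    using xy yz by (auto simp: path_arcs_def)
  then have sub: "{(y, x), (y, z)} \<subseteq> out_arcs (with_proj G) y"
    using path_arcs_subset by (auto simp: out_arcs_def)
  have "card (out_arcs (with_proj G) y) = 2"
    using interior_degree[of y] y by (simp add: out_degree_def path_verts_def)
  moreover have "finite (out_arcs (with_proj G) y)"
    using finite_arcs by (auto simp: out_arcs_def)
  ultimately have "out_arcs (with_proj G) y = {(y, x), (y, z)}"
    using sub \<open>x \<noteq> z\<close> by (intro card_subset_eq[symmetric]) auto
  moreover have "(y, t) \<in> out_arcs (with_proj G) y"
    using t by (simp add: out_arcs_def)
  ultimately show ?thesis
    using \<open>{(y, x), (y, z)} \<subseteq> path_arcs\<close> by blast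
qed

lemma w_in_far_side: "w \<in> far_side"
  using path_verts_subset ends_in_path_verts
  by (auto simp: far_side_def awalk_Nil_iff intro!: exI[of _ "[]"])

lemma far_side_step:
  assumes "x \<in> far_side" "(x, y) \<in> parcs G" "(x, y) \<notin> path_arcs"
  shows "y \<in> far_side"
proof -
  obtain q where "awalk w q x" "set q \<inter> path_arcs = {}"
    using assms(1) by (auto simp: far_side_def)
  moreover have "awalk x [(x, y)] y"
    using assms(2) arc_implies_awalk[of "(x, y)"] by simp
  ultimately have "awalk w (q @ [(x, y)]) y \<and> set (q @ [(x, y)]) \<inter> path_arcs = {}"
    using assms(3) awalk_appendI[of w q x "[(x, y)]" y] by auto
  then show ?thesis unfolding far_side_def by blast
qed

lemma far_side_arc_iff:
  assumes "(x, y) \<in> parcs G" "(x, y) \<notin> path_arcs"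
  shows "x \<in> far_side \<longleftrightarrow> y \<in> far_side"
  using assms far_side_step arcs_symmetric path_arcs_sym by blast

lemma interior_notin_far_side:
  assumes "y \<in> set path_verts" "y \<noteq> u" "y \<noteq> w"
  shows "y \<notin> far_side"
proof
  assume "y \<in> far_side"
  then obtain q where q: "awalk w q y" "set q \<inter> path_arcs = {}"
    by (auto simp: far_side_def)
  have "q \<noteq> []"
    using q assms by (auto simp: awalk_Nil_iff)
  then obtain r e where r: "q = r @ [e]"
    by (metis append_butlast_last_id)
  then have "e \<in> parcs G" "snd e = y"
    using q(1) by (auto simp: awalk_simps)
  then have "(y, fst e) \<in> path_arcs"
    using interior_arc[OF assms] arcs_symmetric[of "fst e" "snd e"] by (metis prod.collapse)
  then have "e \<in> path_arcs"
    using path_arcs_sym[of y "fst e"] \<open>snd e = y\<close> by (cases e) auto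
  then show False using q r by auto
qed

lemma awalk_verts_far_side:
  assumes "awalk w q v" "set q \<inter> path_arcs = {}" "x \<in> set (awalk_verts w q)"
  shows "x \<in> far_side"
proof -
  obtain r s where "q = r @ s" "awalk w r x"
    using awalk_decomp[OF assms(1,3)] by metis
  then show ?thesis
    using assms(2) by (auto simp: far_side_def)
qed

text \<open>
  A walk from \<open>w\<close> to \<open>u\<close> that avoids the edges of the path shortens to a path, which meets \<open>P\<close> only in
  the two ends because the interior of \<open>P\<close> cannot be reached. Together they form the
  excluded cycle.
\<close>

lemma u_notin_far_side: "u \<notin> far_side"
proof
  assume "u \<in> far_side"
  then obtain q0 where q0: "awalk w q0 u" "set q0 \<inter> path_arcs = {}"
    by (auto simp: far_side_def)
  define q where "q = awalk_to_apath q0"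
  have q: "apath w q u" "set q \<inter> path_arcs = {}"
    using apath_awalk_to_apath[OF q0(1)] awalk_to_apath_subset[OF q0(1)] q0(2)
    by (auto simp: q_def)
  then have qw: "awalk w q u" and q_dist: "distinct (awalk_verts w q)"
    by (auto simp: apath_def)
  have Pw: "awalk u P w"
    using path by (simp add: apath_def)
  have closed: "awalk u (P @ q) u"
    using Pw qw by (rule awalk_appendI)
  have "q \<noteq> []"
    using qw ends by (auto simp: awalk_Nil_iff)
  have verts_q: "awalk_verts w q = w # tl (awalk_verts w q)"
    using awhd_of_awalk[OF qw] by (metis awalk_verts_non_Nil list.collapse)
  have verts_P: "path_verts = u # tl path_verts"
    using awhd_of_awalk[OF Pw] by (metis awalk_verts_non_Nil list.collapse path_verts_def)
  have disj: "set (tl path_verts) \<inter> set (tl (awalk_verts w q)) = {}"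
  proof (rule ccontr)
    assume "\<not> ?thesis"
    then obtain x where x: "x \<in> set (tl path_verts)" "x \<in> set (tl (awalk_verts w q))"
      by blast
    have "x \<noteq> w"
      using x(2) q_dist verts_q by (metis distinct.simps(2))
    moreover have "x \<noteq> u"
      using x(1) distinct_path_verts verts_P by (metis distinct.simps(2))
    moreover have "x \<in> set path_verts"
      using x(1) verts_P by (metis list.set_intros(2))
    moreover have "x \<in> far_side"
      using awalk_verts_far_side[OF qw q(2)] x(2) verts_q by (metis list.set_intros(2))
    ultimately show False
      using interior_notin_far_side by blast
  qed
  have "awalk_verts u (P @ q) = path_verts @ tl (awalk_verts w q)"
    using awalk_verts_append[OF closed] awlast_if_cas[of u P w] Pw
    by (auto simp: path_verts_def)
  then have "tl (awalk_verts u (P @ q)) = tl path_verts @ tl (awalk_verts w q)"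
    using verts_P by (metis append_Cons list.sel(3))
  then have "distinct (tl (awalk_verts u (P @ q)))"
    using disj distinct_path_verts q_dist by (simp add: distinct_tl)
  then have cycle: "cycle (P @ q)"
    using closed path_nonempty by (auto simp: cycle_def)
  have "fst (hd P) = u"
    using Pw path_nonempty by (cases P) (auto simp: awalk_Cons_iff)
  moreover have fst_q: "fst (hd q) = w"
    using qw \<open>q \<noteq> []\<close> by (cases q) (auto simp: awalk_Cons_iff)
  ultimately have "u \<in> fst ` set (P @ q)" "w \<in> fst ` set (P @ q)"
    using path_nonempty \<open>q \<noteq> []\<close> by (metis hd_in_set imageI set_append UnI1) 
      (metis fst_q \<open>q \<noteq> []\<close> hd_in_set imageI set_append UnI2)
  moreover have "3 \<le> length (P @ q)"
  proof (rule ccontr)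
    assume "\<not> ?thesis"
    moreover have "0 < length P" "0 < length q"
      using path_nonempty \<open>q \<noteq> []\<close> by auto
    ultimately have "length P = 1" "length q = 1"
      unfolding length_append by linarith+
    then obtain e e' where "P = [e]" "q = [e']"
      by (auto simp: length_Suc_conv)
    with Pw qw have "(u, w) \<in> set P" "(w, u) \<in> set q"
      by (cases e; cases e'; auto simp: awalk_simps)+
    with q(2) show False unfolding path_arcs_def by blast
  qed
  ultimately show False
    using cycle no_cycle unfolding in_common_cycle_def by blast
qed

lemma path_verts_far_side:
  assumes "x \<in> set path_verts"
  shows "x \<in> far_side \<longleftrightarrow> x = w"
  using assms interior_notin_far_side u_notin_far_side w_in_far_side by blast

lemma off_path_arc_path_vertex:
  assumes "(x, y) \<in> parcs G" "(x, y) \<notin> path_arcs" "x \<in> set path_verts"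
  shows "x = u \<or> x = w"
  using assms interior_arc by blast

section \<open>Reflection of the path\<close>

definition reflect :: "'a \<Rightarrow> 'a" where
  "reflect x = the (map_of (zip path_verts (rev path_verts)) x)"

lemma reflect_nth:
  assumes "i \<le> length P"
  shows "reflect (path_verts ! i) = path_verts ! (length P - i)"
  using map_of_zip_nth[of path_verts "rev path_verts" i] assms distinct_path_verts
  by (simp add: reflect_def length_path_verts rev_nth)

lemma reflect_in_path_verts: "x \<in> set path_verts \<Longrightarrow> reflect x \<in> set path_verts"
  by (metis diff_le_self mem_path_verts reflect_nth)

lemma reflect_reflect: "x \<in> set path_verts \<Longrightarrow> reflect (reflect x) = x"
  by (auto simp: mem_path_verts reflect_nth)

lemma reflect_ends: "reflect u = w" "reflect w = u"
  using reflect_nth[of 0] reflect_nth[of "length P"] path_verts_first path_verts_last by auto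

lemma reflect_path_arcs:
  assumes "(x, y) \<in> path_arcs"
  shows "(reflect x, reflect y) \<in> path_arcs"
proof -
  have *: "(reflect b, reflect a) \<in> set P" if "(a, b) \<in> set P" for a b
  proof -
    obtain i where i: "i < length P" "a = path_verts ! i" "b = path_verts ! Suc i"
      using \<open>(a, b) \<in> set P\<close> by (auto simp: mem_path)
    then have "reflect b = path_verts ! (length P - Suc i)"
      "reflect a = path_verts ! Suc (length P - Suc i)"
      by (simp_all add: reflect_nth Suc_diff_Suc)
    then show ?thesis
      using i by (auto simp: mem_path intro!: exI[of _ "length P - Suc i"])
  qed
  show ?thesis
    using assms *[of x y] *[of y x] by (auto simp: path_arcs_def)
qed

section \<open>Distances in the shifted graph\<close>

definition shifted :: "'a pair_pre_digraph" where
  "shifted = move_neighbours G w {z. (w, z) \<in> parcs G \<and> z \<noteq> fst (last P)} u"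

lemma pverts_shifted: "pverts shifted = pverts G"
  by (simp add: shifted_def move_neighbours_def)

lemma wf_shifted: "pair_wf_digraph shifted"
  using path_verts_subset ends_in_path_verts
  by unfold_locales
    (auto simp: shifted_def move_neighbours_def dest: wellformed' in_arcsD1 in_arcsD2)

text \<open>
  The shift excepts one neighbour of \<open>w\<close>, the last but one vertex of the path. It is the only
  neighbour of \<open>w\<close> along an edge of the path, so the shift moves exactly the edges
  from \<open>w\<close> to the far side.
\<close>

lemma path_arc_at_w:
  assumes "(w, z) \<in> path_arcs"
  shows "z = fst (last P)"
proof -
  have index: "i = length P" if "path_verts ! i = w" "i \<le> length P" for i
    using nth_eq_iff_index_eq[OF distinct_path_verts, of i "length P"] that path_verts_last
    by (simp add: length_path_verts)
  have "(w, z) \<notin> set P"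
    using index by (force simp: mem_path)
  then have "(z, w) \<in> set P"
    using assms by (auto simp: path_arcs_def)
  then obtain i where i: "i < length P" "z = path_verts ! i" "w = path_verts ! Suc i"
    by (auto simp: mem_path)
  then have "Suc i = length P"
    using index[of "Suc i"] by simp
  then have "last P = P ! i"
    using last_conv_nth[OF path_nonempty] by (metis diff_Suc_1)
  then show ?thesis
    using path_nth[OF i(1)] i(2) by simp
qed

lemma last_arc: "(w, fst (last P)) \<in> path_arcs"
proof -
  have "last P = P ! (length P - 1)"
    using path_nonempty by (rule last_conv_nth)
  then have "snd (last P) = w"
    using path_nth[of "length P - 1"] path_verts_last path_nonempty by simp
  then show ?thesis
    using path_nonempty last_in_set[of P] by (cases "last P") (auto simp: path_arcs_def)
qed

lemma shifted_path_arc: "(x, y) \<in> path_arcs \<Longrightarrow> (x, y) \<in> parcs shifted"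
  using path_arc_at_w path_arcs_subset path_arcs_sym
  by (auto simp: shifted_def move_neighbours_def)

lemma shifted_unmoved_arc:
  "(x, y) \<in> parcs G \<Longrightarrow> x \<noteq> w \<Longrightarrow> y \<noteq> w \<Longrightarrow> (x, y) \<in> parcs shifted"
  by (auto simp: shifted_def move_neighbours_def)

lemma shifted_moved_arc:
  assumes "(w, z) \<in> parcs G" "(w, z) \<notin> path_arcs"
  shows "(u, z) \<in> parcs shifted" "(z, u) \<in> parcs shifted"
proof -
  have "z \<noteq> fst (last P)"
    using assms last_arc by blast
  then show "(u, z) \<in> parcs shifted" "(z, u) \<in> parcs shifted"
    using assms by (auto simp: shifted_def move_neighbours_def)
qed

text \<open>The far side is reattached at \<open>u\<close>, so the new arc is found by renaming \<open>w\<close> to \<open>u\<close>.\<close>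

lemma shifted_far_arc:
  assumes "(x, y) \<in> parcs G" "(x, y) \<notin> path_arcs"
  shows "(if x = w then u else x, if y = w then u else y) \<in> parcs shifted"
proof -
  have "x \<noteq> y"
    using no_loops'[OF assms(1)] .
  moreover have "(y, x) \<in> parcs G" "(y, x) \<notin> path_arcs"
    using assms arcs_symmetric path_arcs_sym by blast+
  ultimately show ?thesis
    using assms shifted_moved_arc shifted_unmoved_arc by auto
qed

lemma lazy_hom_shiftedI:
  assumes "\<And>x. x \<in> pverts G \<Longrightarrow> f x \<in> pverts G"
    and "\<And>x y. (x, y) \<in> path_arcs \<Longrightarrow> f x = f y \<or> (f x, f y) \<in> parcs shifted"
    and "\<And>x y. (x, y) \<in> parcs G \<Longrightarrow> (x, y) \<notin> path_arcs \<Longrightarrow> x \<in> far_side \<Longrightarrow> y \<in> far_side \<Longrightarrow>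
      f x = f y \<or> (f x, f y) \<in> parcs shifted"
    and "\<And>x y. (x, y) \<in> parcs G \<Longrightarrow> (x, y) \<notin> path_arcs \<Longrightarrow> x \<notin> far_side \<Longrightarrow> y \<notin> far_side \<Longrightarrow>
      f x = f y \<or> (f x, f y) \<in> parcs shifted"
  shows "lazy_hom f G shifted"
  unfolding lazy_hom_def pverts_shifted using assms far_side_arc_iff by blast

text \<open>
  The identity fails on the moved edges from \<open>w\<close> to \<open>B\<close>. Either these are collapsed, or \<open>w\<close> goes to
  \<open>u\<close>; then the path must be collapsed to keep \<open>u\<close> joined to \<open>A\<close>, or it can be reflected
  if \<open>A\<close> is collapsed.
\<close>

definition collapse_far :: "'a \<Rightarrow> 'a" where
  "collapse_far x = (if x \<in> far_side then w else x)"

definition collapse_path :: "'a \<Rightarrow> 'a" where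
  "collapse_path x = (if x \<in> set path_verts then u else x)"

definition reflect_collapse_near :: "'a \<Rightarrow> 'a" where
  "reflect_collapse_near x =
     (if x \<in> set path_verts then reflect x else if x \<in> far_side then x else w)"

lemma lazy_hom_collapse_far: "lazy_hom collapse_far G shifted"
proof (rule lazy_hom_shiftedI)
  fix x assume "x \<in> pverts G"
  then show "collapse_far x \<in> pverts G"
    using path_verts_subset ends_in_path_verts by (auto simp: collapse_far_def)
next
  fix x y assume xy: "(x, y) \<in> path_arcs"
  then have "collapse_far x = x" "collapse_far y = y"
    using path_arcs_in_path_verts[OF xy] path_verts_far_side by (auto simp: collapse_far_def)
  then show "collapse_far x = collapse_far y \<or> (collapse_far x, collapse_far y) \<in> parcs shifted"
    using xy shifted_path_arc by simp
next
  fix x y assume "x \<in> far_side" "y \<in> far_side"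
  then show "collapse_far x = collapse_far y \<or> (collapse_far x, collapse_far y) \<in> parcs shifted"
    by (simp add: collapse_far_def)
next
  fix x y assume "(x, y) \<in> parcs G" "x \<notin> far_side" "y \<notin> far_side"
  then show "collapse_far x = collapse_far y \<or> (collapse_far x, collapse_far y) \<in> parcs shifted"
    using shifted_unmoved_arc w_in_far_side by (auto simp: collapse_far_def)
qed

lemma lazy_hom_collapse_path: "lazy_hom collapse_path G shifted"
proof (rule lazy_hom_shiftedI)
  fix x assume "x \<in> pverts G"
  then show "collapse_path x \<in> pverts G"
    using path_verts_subset ends_in_path_verts by (auto simp: collapse_path_def)
next
  fix x y assume "(x, y) \<in> path_arcs"
  then show "collapse_path x = collapse_path y \<or> (collapse_path x, collapse_path y) \<in> parcs shifted"
    using path_arcs_in_path_verts by (auto simp: collapse_path_def)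
next
  fix x y assume *: "(x, y) \<in> parcs G" "(x, y) \<notin> path_arcs" "x \<in> far_side" "y \<in> far_side"
  then have "collapse_path x = (if x = w then u else x)" "collapse_path y = (if y = w then u else y)"
    using path_verts_far_side ends_in_path_verts by (auto simp: collapse_path_def)
  then show "collapse_path x = collapse_path y \<or> (collapse_path x, collapse_path y) \<in> parcs shifted"
    using shifted_far_arc[OF *(1,2)] by simp
next
  fix x y assume *: "(x, y) \<in> parcs G" "(x, y) \<notin> path_arcs" "x \<notin> far_side" "y \<notin> far_side"
  then have "collapse_path x = x"
    using off_path_arc_path_vertex[OF *(1,2)] w_in_far_side by (auto simp: collapse_path_def)
  moreover have "collapse_path y = y"
    using off_path_arc_path_vertex[of y x] arcs_symmetric[OF *(1)] path_arcs_sym *(2,4) w_in_far_side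
    by (auto simp: collapse_path_def)
  ultimately show "collapse_path x = collapse_path y \<or> (collapse_path x, collapse_path y) \<in> parcs shifted"
    using shifted_unmoved_arc[OF *(1)] *(3,4) w_in_far_side by auto
qed

lemma lazy_hom_reflect_collapse_near: "lazy_hom reflect_collapse_near G shifted"
proof (rule lazy_hom_shiftedI)
  fix x assume "x \<in> pverts G"
  then show "reflect_collapse_near x \<in> pverts G"
    using path_verts_subset ends_in_path_verts reflect_in_path_verts
    by (auto simp: reflect_collapse_near_def)
next
  fix x y assume xy: "(x, y) \<in> path_arcs"
  then show "reflect_collapse_near x = reflect_collapse_near y \<or>
      (reflect_collapse_near x, reflect_collapse_near y) \<in> parcs shifted"
    using path_arcs_in_path_verts[OF xy] shifted_path_arc[OF reflect_path_arcs[OF xy]]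
    by (auto simp: reflect_collapse_near_def)
next
  fix x y assume *: "(x, y) \<in> parcs G" "(x, y) \<notin> path_arcs" "x \<in> far_side" "y \<in> far_side"
  then have "reflect_collapse_near x = (if x = w then u else x)"
    "reflect_collapse_near y = (if y = w then u else y)"
    using path_verts_far_side ends_in_path_verts reflect_ends
    by (auto simp: reflect_collapse_near_def)
  then show "reflect_collapse_near x = reflect_collapse_near y \<or>
      (reflect_collapse_near x, reflect_collapse_near y) \<in> parcs shifted"
    using shifted_far_arc[OF *(1,2)] by simp
next
  \<comment> \<open>The near part meets the path only in \<open>u\<close>, whose mirror image is \<open>w\<close>: both ends go to \<open>w\<close>.\<close>
  fix x y assume *: "(x, y) \<in> parcs G" "(x, y) \<notin> path_arcs" "x \<notin> far_side" "y \<notin> far_side"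
  then have "reflect_collapse_near x = w"
    using off_path_arc_path_vertex[OF *(1,2)] w_in_far_side reflect_ends
    by (auto simp: reflect_collapse_near_def)
  moreover have "reflect_collapse_near y = w"
    using off_path_arc_path_vertex[of y x] arcs_symmetric[OF *(1)] path_arcs_sym *(2,4) w_in_far_side
      reflect_ends
    by (auto simp: reflect_collapse_near_def)
  ultimately show "reflect_collapse_near x = reflect_collapse_near y \<or>
      (reflect_collapse_near x, reflect_collapse_near y) \<in> parcs shifted"
    by simp
qed

section \<open>Comparison of the Wiener indices\<close>

text \<open>
  The involution on ordered pairs that matches each pair with one whose old distance bounds
  the new distance of its image.
\<close>

definition exchange :: "'a \<times> 'a \<Rightarrow> 'a \<times> 'a" where
  "exchange = (\<lambda>(x, y).
     if x \<in> set path_verts \<and> y \<in> far_side - {w} then (reflect x, y)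
     else if x \<in> far_side - {w} \<and> y \<in> set path_verts then (x, reflect y)
     else (x, y))"

lemma bij_betw_exchange: "bij_betw exchange (pverts G \<times> pverts G) (pverts G \<times> pverts G)"
proof -
  have "exchange (exchange z) = z" for z
    using reflect_in_path_verts reflect_reflect path_verts_far_side
    by (cases z) (auto simp: exchange_def)
  moreover have "exchange ` (pverts G \<times> pverts G) \<subseteq> pverts G \<times> pverts G"
    using reflect_in_path_verts subsetD[OF path_verts_subset]
    by (auto simp: exchange_def split: if_splits)
  ultimately show ?thesis
    by (intro bij_betw_byWitness[where f' = exchange]) auto
qed

text \<open>
  For each kind of pair, one of the three maps acts on it as the exchange does: collapsing the far
  side fixes pairs outside \<open>B\<close>; reflecting the path serves pairs inside \<open>B\<close> and pairs between
  \<open>B\<close> and the path; collapsing the path fixes pairs between \<open>A\<close> and \<open>B\<close>.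
\<close>

lemma dist_exchange_le:
  "graph_dist shifted (fst (exchange (x, y))) (snd (exchange (x, y))) \<le> graph_dist G x y"
proof -
  note bound = graph_dist_lazy_hom[OF pair_wf_digraph wf_shifted]
  note far = bound[OF lazy_hom_collapse_far, of x y]
  note mid = bound[OF lazy_hom_collapse_path, of x y]
  note near = bound[OF lazy_hom_reflect_collapse_near, of x y]
  let ?B = "far_side - {w}"
  have off: "z \<notin> set path_verts" if "z \<in> ?B" for z
    using that path_verts_far_side by blast
  consider "x \<notin> ?B" "y \<notin> ?B" | "x \<in> ?B" "y \<in> ?B"
    | "x \<in> ?B" "y \<in> set path_verts" | "y \<in> ?B" "x \<in> set path_verts"
    | "x \<in> ?B" "y \<notin> ?B" "y \<notin> set path_verts" | "y \<in> ?B" "x \<notin> ?B" "x \<notin> set path_verts"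
    by blast
  then show ?thesis
  proof cases
    case 1
    then have "collapse_far x = x" "collapse_far y = y"
      by (auto simp: collapse_far_def)
    then show ?thesis using far 1 by (auto simp: exchange_def)
  next
    case 2
    then show ?thesis using near off by (auto simp: exchange_def reflect_collapse_near_def)
  next
    case 3
    then show ?thesis using near off by (auto simp: exchange_def reflect_collapse_near_def)
  next
    case 4
    then show ?thesis using near off by (auto simp: exchange_def reflect_collapse_near_def)
  next
    case 5
    then show ?thesis using mid off by (auto simp: exchange_def collapse_path_def)
  next
    case 6
    then show ?thesis using mid off by (auto simp: exchange_def collapse_path_def)
  qed
qed

lemma wiener_index_shifted_le: "wiener_index shifted \<le> wiener_index G"
proof -
  let ?V = "pverts G \<times> pverts G"
  have "wiener_index shifted = (\<Sum>z\<in>?V. graph_dist shifted (fst z) (snd z))"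
    by (simp add: wiener_index_def pverts_shifted sum.cartesian_product case_prod_unfold)
  also have "\<dots> = (\<Sum>z\<in>?V. graph_dist shifted (fst (exchange z)) (snd (exchange z)))"
    by (rule sum.reindex_bij_betw[OF bij_betw_exchange, symmetric])
  also have "\<dots> \<le> (\<Sum>z\<in>?V. graph_dist G (fst z) (snd z))"
    using dist_exchange_le by (intro sum_mono) auto
  also have "\<dots> = wiener_index G"
    by (simp add: wiener_index_def sum.cartesian_product case_prod_unfold)
  finally show ?thesis .
qed

end

theorem theorem20:
  fixes G1 G2 :: "'a pair_pre_digraph" and n :: nat
  assumes "pair_graph G1" and "connected (with_proj G1)" and "card (pverts G1) = n"
    and "pair_graph G2" and "connected (with_proj G2)" and "card (pverts G2) = n"
    and "GGS G1 G2"
  shows "wiener_index G1 \<ge> wiener_index G2"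
proof -
  obtain u w P where uwP: "u \<noteq> w" "pre_digraph.apath (with_proj G1) u P w"
      "\<forall>x \<in> set (pre_digraph.awalk_verts (with_proj G1) u P) - {u, w}.
         out_degree (with_proj G1) x = 2"
      "\<not> in_common_cycle G1 u w"
    and G2: "G2 = move_neighbours G1 w {z. (w, z) \<in> parcs G1 \<and> z \<noteq> fst (last P)} u"
    using \<open>GGS G1 G2\<close> unfolding GGS_def Let_def by blast
  interpret pair_graph G1 by fact
  interpret shift_path G1 u w P
    using uwP by unfold_locales (auto simp: awalk_verts_with_proj_eq)
  show ?thesis
    using wiener_index_shifted_le by (simp add: shifted_def G2)
qed

end
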